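(* Let $T>0$, $I=[0,T]$, $q\in(0,1]$, $0<t_1\le t_2\le\cdots\le t_k<T$, $\iota_1,\dots,\iota_k\in R$, $x_0\in R^n$, and for $j=1,\dots,m$ let $S_j,D_j:R^m\times R^n\to R$ and $a_j,b_j:R^{m-1}\to R$; let $\chi:I\times R^n\to R^n$ and $\vartheta:I\times R^n\times R^m\to R^n$. Assume: (A1) there are constants $\eta_{SD},l_{Sj},l_{Dj}>0$ ($j=1,\dots,m$) such that for all $x\in R^n$ and $u^1,u^2\in R^m$, $$\sum_{j=1}^mS_j(u^1,x)(u_j^2-u_j^1)+\sum_{j=1}^mD_j(u^1,x)(u_j^1-u_j^2)\ge 0$$ implies $$\sum_{j=1}^mS_j(u^2,x)(u_j^2-u_j^1)+\sum_{j=1}^mD_j(u^2,x)(u_j^1-u_j^2)\ge\eta_{SD}\|u^2-u^1\|^2,$$ and for all $x^1,x^2\in R^n$, $u^1,u^2\in R^m$ and each $j$, $|S_j(u^1,x^1)-S_j(u^2,x^2)|\le l_{Sj}(\|x^1-x^2\|+\|u^1-u^2\|)$ and $|D_j(u^1,x^1)-D_j(u^2,x^2)|\le l_{Dj}(\|x^1-x^2\|+\|u^1-u^2\|)$; (A2) for each $j$, $a_j(u_{-j})=\phi_j(u_{-j})+c_j$ and $b_j(u_{-j})=\phi_j(u_{-j})+d_j$ for all $u_{-j}\in R^{m-1}$, where $c_j<d_j$ are positive constants and $\phi_j:R^{m-1}\to R$ is $l_j$-Lipschitz, and, with $l=(l_1,\dots,l_m)^\top$, $l_S=(l_{S1},\dots,l_{Sm})^\top$,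 $l_D=(l_{D1},\dots,l_{Dm})^\top$, $$2\frac{\|l\|_1^2}{\eta_{SD}^2}\left((\|l_S\|_1+\|l_D\|_1)\sqrt{4(\|l_S\|_1+\|l_D\|_1)^2+2\eta_{SD}^2}+2(\|l_S\|_1+\|l_D\|_1)^2+\eta_{SD}^2\right)<1;$$ (A3) $\vartheta$ is continuous and there is $l_\vartheta>0$ with $\|\vartheta(s,x^2,u^2)-\vartheta(s,x^1,u^1)\|\le l_\vartheta(\|x^2-x^1\|+\|u^2-u^1\|)$ for all $s\in I$, $x^1,x^2\in R^n$, $u^1,u^2\in R^m$; (A4) $\chi$ is continuous and there is $l_\chi>0$ with $\|\chi(s,x^2)-\chi(s,x^1)\|\le l_\chi\|x^2-x^1\|$ for all $s\in I$, $x^1,x^2\in R^n$; (A5) $0<\sum_{i=1}^k|\iota_i|<1$. If $\varphi\in C(I,R_+)$ is a nondecreasing function, then the price control problem (PCP) $$\begin{cases}{}^{C}_{0}\mathrm{D}_s^{q}x(s)=\chi(s,x(s))+\vartheta(s,x(s),u(s)), & s\in I,\\ \langle S(u(s),x(s))-D(u(s),x(s)),v-u(s)\rangle\ge 0\ \ \forall v\in K(u(s)), & s\in I,\\ x(0)=x_0+\sum_{i=1}^k\iota_ix(t_i)\end{cases}$$ is generalized Mittag-Leffler-Hyers-Ulam-Rassias stable with respect to $\varphi\mathrm{E}_q$.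
   Context: $R_+=[0,\infty)$. $\|\cdot\|$ is the Euclidean norm and $\|\cdot\|_1$ the $1$-norm. For $u\in R^m$, $u_{-j}\in R^{m-1}$ denotes $u$ with its $j$-th component omitted. $S=(S_1,\dots,S_m)^\top$, $D=(D_1,\dots,D_m)^\top$ and, for $u\in R^m$, $K(u)=\{w\in R^m: a_j(u_{-j})\le w_j\le b_j(u_{-j}),\ j=1,\dots,m\}$. ${}^{C}_{0}\mathrm{D}_s^{q}$ is the Caputo fractional derivative of order $q$. $\mathrm{E}_q(t)=\sum_{n=0}^\infty\frac{t^n}{\Gamma(nq+1)}$ is the Mittag-Leffler function. A solution of the PCP is a pair $(x,u)\in C(I,R^n)\times C(I,R^m)$ such that for all $s\in I$: $x(s)=x_0+\sum_{i=1}^k\iota_ix(t_i)+\frac{1}{\Gamma(q)}\int_0^s(s-\zeta)^{q-1}[\chi(\zeta,x(\zeta))+\vartheta(\zeta,x(\zeta),u(\zeta))]\,d\zeta$, $u(s)\in K(u(s))$, and $\langle S(u(s),x(s))-D(u(s),x(s)),v-u(s)\rangle\ge 0$ for all $v\in K(u(s))$. Generalized Mittag-Leffler-Hyers-Ulam-Rassias stability with respect to $\varphi\mathrm{E}_q$ means: there exists a real number $c_\varphi>0$ such that for each solution $(z,\upsilon)\in C(I,R^n)\times C(I,R^m)$ of the system $$\begin{cases}\left\|{}^{C}_{0}\mathrm{D}_s^{q}z(s)-\chi(s,z(s))-\vartheta(s,z(s),\upsilon(s))\right\|\le\varphi(s), & s\in I,\\ \upsilon(s)\in K(\upsilon(s)),\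 \langle S(\upsilon(s),z(s))-D(\upsilon(s),z(s)),v-\upsilon(s)\rangle\ge 0\ \ \forall v\in K(\upsilon(s)), & s\in I,\\ z(0)=x(0),\end{cases}$$ where $x$ is the trajectory (first component) of a solution $(x,u)$ of the PCP, there exists such a solution $(x,u)$ of the PCP with $\|z(s)-x(s)\|\le c_\varphi\,\varphi(s)\,\mathrm{E}_q(s)$ for all $s\in I$. The first line of the system holds iff there is $h\in C(I,R^n)$ with $\|h(s)\|\le\varphi(s)$ on $I$ and $z(s)=z(0)+\frac{1}{\Gamma(q)}\int_0^s(s-\zeta)^{q-1}[\chi(\zeta,z(\zeta))+\vartheta(\zeta,z(\zeta),\upsilon(\zeta))+h(\zeta)]\,d\zeta$ for all $s\in I$. *)

theory Defs
  imports "HOL-Analysis.Analysis"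
begin

definition norm1 :: "real ^ 'm \<Rightarrow> real" where
  "norm1 v = (\<Sum>j\<in>UNIV. \<bar>v $ j\<bar>)"

(* The vectors of R^(m-1) left after omitting index j are the families indexed by
   the remaining indices, that is, the elements of extensional (- {j}). *)
definition omit :: "'m \<Rightarrow> real ^ 'm \<Rightarrow> ('m \<Rightarrow> real)" where
  "omit j u = restrict (($) u) (- {j})"

(* L2_set over - {j} is the Euclidean norm of that R^(m-1). *)
definition lipschitz_omit :: "'m \<Rightarrow> real \<Rightarrow> (('m::finite \<Rightarrow> real) \<Rightarrow> real) \<Rightarrow> bool" where
  "lipschitz_omit j L f \<longleftrightarrow> 0 \<le> L \<and>
     (\<forall>v\<in>extensional (- {j}). \<forall>w\<in>extensional (- {j}).
        \<bar>f v - f w\<bar> \<le> L * L2_set (\<lambda>i. v i - w i) (- {j}))"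

definition price_set ::
  "('m \<Rightarrow> ('m \<Rightarrow> real) \<Rightarrow> real) \<Rightarrow> ('m \<Rightarrow> ('m \<Rightarrow> real) \<Rightarrow> real) \<Rightarrow> real ^ 'm \<Rightarrow> (real ^ 'm) set" where
  "price_set a b u = {w. \<forall>j. a j (omit j u) \<le> w $ j \<and> w $ j \<le> b j (omit j u)}"

definition solves_qvi ::
  "(real ^ 'm \<Rightarrow> real ^ 'n \<Rightarrow> real ^ 'm) \<Rightarrow> (real ^ 'm \<Rightarrow> real ^ 'n \<Rightarrow> real ^ 'm) \<Rightarrow>
   ('m::finite \<Rightarrow> ('m \<Rightarrow> real) \<Rightarrow> real) \<Rightarrow> ('m \<Rightarrow> ('m \<Rightarrow> real) \<Rightarrow> real) \<Rightarrow>
   real ^ 'n::finite \<Rightarrow> real ^ 'm \<Rightarrow> bool" where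
  "solves_qvi S D a b x u \<longleftrightarrow> u \<in> price_set a b u \<and>
     (\<forall>v\<in>price_set a b u. (S u x - D u x) \<bullet> (v - u) \<ge> 0)"

(* Riemann-Liouville integral with base point 0; order 0 is the identity and is treated
   separately because Gamma 0 = 0 in HOL. *)
definition rl_integral :: "real \<Rightarrow> (real \<Rightarrow> 'a::euclidean_space) \<Rightarrow> real \<Rightarrow> 'a" where
  "rl_integral q f s =
     (if q = 0 then f s
      else (1 / Gamma q) *\<^sub>R integral {0..s} (\<lambda>\<zeta>. (s - \<zeta>) powr (q - 1) *\<^sub>R f \<zeta>))"

(* y is the Caputo derivative of order q of z on [0,T], 0 < q \<le> 1, in the form
   d/ds I^(1-q) (z - z 0), which does not require z to be absolutely continuous;
   one-sided derivatives at the endpoints. For q = 1 it is the ordinary derivative. *)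
definition has_caputo_derivative_on ::
  "real \<Rightarrow> real \<Rightarrow> (real \<Rightarrow> 'a::euclidean_space) \<Rightarrow> (real \<Rightarrow> 'a) \<Rightarrow> bool" where
  "has_caputo_derivative_on q T z y \<longleftrightarrow>
     (\<forall>s\<in>{0..T}. (rl_integral (1 - q) (\<lambda>\<zeta>. z \<zeta> - z 0) has_vector_derivative y s)
        (at s within {0..T}))"

definition mittag_leffler :: "real \<Rightarrow> real \<Rightarrow> real" where
  "mittag_leffler q t = (\<Sum>n. t ^ n / Gamma (real n * q + 1))"

definition pcp_solution ::
  "real \<Rightarrow> real \<Rightarrow> nat \<Rightarrow> (nat \<Rightarrow> real) \<Rightarrow> (nat \<Rightarrow> real) \<Rightarrow> real ^ 'n \<Rightarrow>
   (real \<Rightarrow> real ^ 'n \<Rightarrow> real ^ 'n) \<Rightarrow> (real \<Rightarrow> real ^ 'n \<Rightarrow> real ^ 'm \<Rightarrow> real ^ 'n) \<Rightarrow>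
   (real ^ 'm \<Rightarrow> real ^ 'n \<Rightarrow> real ^ 'm) \<Rightarrow> (real ^ 'm \<Rightarrow> real ^ 'n \<Rightarrow> real ^ 'm) \<Rightarrow>
   ('m::finite \<Rightarrow> ('m \<Rightarrow> real) \<Rightarrow> real) \<Rightarrow> ('m \<Rightarrow> ('m \<Rightarrow> real) \<Rightarrow> real) \<Rightarrow>
   (real \<Rightarrow> real ^ 'n::finite) \<Rightarrow> (real \<Rightarrow> real ^ 'm) \<Rightarrow> bool" where
  "pcp_solution T q k t \<iota> x0 chi theta S D a b x u \<longleftrightarrow>
     continuous_on {0..T} x \<and> continuous_on {0..T} u \<and>
     (\<forall>s\<in>{0..T}.
        x s = x0 + (\<Sum>i=1..k. \<iota> i *\<^sub>R x (t i))
                 + rl_integral q (\<lambda>\<zeta>. chi \<zeta> (x \<zeta>) + theta \<zeta> (x \<zeta>) (u \<zeta>)) s \<and>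
        solves_qvi S D a b (x s) (u s))"

(* The Caputo derivative of z is required to be continuous. With this, the condition is
   equivalent to z = z 0 + I^q (chi + theta + h) for some continuous h with norm (h s) \<le> \<phi> s,
   namely h = y - chi - theta. *)
definition pcp_perturbed_solution ::
  "real \<Rightarrow> real \<Rightarrow>
   (real \<Rightarrow> real ^ 'n \<Rightarrow> real ^ 'n) \<Rightarrow> (real \<Rightarrow> real ^ 'n \<Rightarrow> real ^ 'm \<Rightarrow> real ^ 'n) \<Rightarrow>
   (real ^ 'm \<Rightarrow> real ^ 'n \<Rightarrow> real ^ 'm) \<Rightarrow> (real ^ 'm \<Rightarrow> real ^ 'n \<Rightarrow> real ^ 'm) \<Rightarrow>
   ('m::finite \<Rightarrow> ('m \<Rightarrow> real) \<Rightarrow> real) \<Rightarrow> ('m \<Rightarrow> ('m \<Rightarrow> real) \<Rightarrow> real) \<Rightarrow> (real \<Rightarrow> real) \<Rightarrow>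
   (real \<Rightarrow> real ^ 'n::finite) \<Rightarrow> (real \<Rightarrow> real ^ 'm) \<Rightarrow> bool" where
  "pcp_perturbed_solution T q chi theta S D a b \<phi> z \<upsilon> \<longleftrightarrow>
     continuous_on {0..T} z \<and> continuous_on {0..T} \<upsilon> \<and>
     (\<exists>y. continuous_on {0..T} y \<and> has_caputo_derivative_on q T z y \<and>
        (\<forall>s\<in>{0..T}. norm (y s - chi s (z s) - theta s (z s) (\<upsilon> s)) \<le> \<phi> s)) \<and>
     (\<forall>s\<in>{0..T}. solves_qvi S D a b (z s) (\<upsilon> s))"

(* Generalized Mittag-Leffler-Hyers-Ulam-Rassias stability with respect to \<phi> E_q. *)
definition gen_MLHUR_stable ::
  "real \<Rightarrow> real \<Rightarrow> nat \<Rightarrow> (nat \<Rightarrow> real) \<Rightarrow> (nat \<Rightarrow> real) \<Rightarrow> real ^ 'n \<Rightarrow>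
   (real \<Rightarrow> real ^ 'n \<Rightarrow> real ^ 'n) \<Rightarrow> (real \<Rightarrow> real ^ 'n \<Rightarrow> real ^ 'm \<Rightarrow> real ^ 'n) \<Rightarrow>
   (real ^ 'm \<Rightarrow> real ^ 'n \<Rightarrow> real ^ 'm) \<Rightarrow> (real ^ 'm \<Rightarrow> real ^ 'n \<Rightarrow> real ^ 'm) \<Rightarrow>
   ('m::finite \<Rightarrow> ('m \<Rightarrow> real) \<Rightarrow> real) \<Rightarrow> ('m \<Rightarrow> ('m \<Rightarrow> real) \<Rightarrow> real) \<Rightarrow>
   (real \<Rightarrow> real) \<Rightarrow> bool" where
  "gen_MLHUR_stable T q k t \<iota> (x0 :: real ^ 'n::finite) chi theta S D a b \<phi> \<longleftrightarrow>
     (\<exists>c>0. \<forall>z \<upsilon>.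
        pcp_perturbed_solution T q chi theta S D a b \<phi> z \<upsilon> \<and>
        (\<exists>x u. pcp_solution T q k t \<iota> x0 chi theta S D a b x u \<and> z 0 = x 0) \<longrightarrow>
        (\<exists>x u. pcp_solution T q k t \<iota> x0 chi theta S D a b x u \<and> z 0 = x 0 \<and>
           (\<forall>s\<in>{0..T}. norm (z s - x s) \<le> c * \<phi> s * mittag_leffler q s)))"

end

theory Submission
  imports Defs
begin

text \<open>Let \<open>(x, u)\<close> be a solution of the PCP and \<open>(z, \<upsilon>)\<close> a perturbed solution with \<open>z 0 = x 0\<close>. The
  distance \<open>|z - x|\<close> is estimated directly, with a constant that depends on neither of them; so
  \<open>(x, u)\<close> itself is the solution that the stability notion asks for.

  The price \<open>u(s)\<close> is a Lipschitz function of the state \<open>x(s)\<close> (\<open>solves_qvi_lipschitz\<close>): the constraint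
  set \<open>K(u)\<close> is a fixed box translated by a vector depending on \<open>u\<close> with Lipschitz constant \<open>norm1 l\<close>,
  and solutions of two strongly pseudomonotone variational inequalities over translates of one set
  can be compared after translating them into the same set. The smallness condition makes the
  resulting estimate absorb its own right-hand side.

  Next, \<open>z\<close> satisfies \<open>z s = z 0 + I\<^sup>q y s\<close>, where \<open>y\<close> is its Caputo derivative and \<open>I\<^sup>q\<close> the
  Riemann-Liouville integral (\<open>caputo_derivative_imp_integral_equation\<close>). This rests on the semigroup
  law \<open>I\<^sup>a I\<^sup>b = I\<^bsup>a+b\<^esup>\<close>, that is, on Fubini's theorem and Euler's Beta integral. Subtracting the integral
  equation of \<open>x\<close>, whose initial terms agree with those of \<open>z\<close>, gives \<open>z - x = I\<^sup>q g\<close> with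
  \<open>|g| \<le> \<phi> + M |z - x|\<close>, where \<open>M\<close> collects the Lipschitz constants of the two vector fields and of
  the price.

  A Gronwall inequality for \<open>I\<^sup>q\<close> (\<open>fractional_Gronwall\<close>) then yields \<open>|z s - x s| \<le> c \<phi> s\<close>: in a norm with
  the weight \<open>exp (-\<rho> s)\<close> and \<open>\<rho>\<close> large, \<open>M I\<^sup>q\<close> is a contraction, and the monotonicity of \<open>\<phi>\<close> keeps
  the value of \<open>\<phi>\<close> at \<open>s\<close> on the right. The weight is bounded on \<open>[0,T]\<close> and goes into \<open>c\<close>. Finally
  \<open>E\<^sub>q \<ge> 1\<close> on \<open>[0,\<infinity>)\<close> (\<open>mittag_leffler_ge_1\<close>), because its series converges, has nonnegative terms and
  starts with \<open>1\<close>.\<close>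

section \<open>Variational inequalities over translated boxes\<close>

text \<open>Lipschitz bounds are given for each component separately; the 1-norm of the vector of their
  constants appears because the Euclidean norm is at most the 1-norm.\<close>
lemma norm_le_norm1_mult:
  fixes v w :: "real ^ 'm::finite"
  assumes "\<And>j. \<bar>v $ j\<bar> \<le> w $ j * e" "0 \<le> e"
  shows "norm v \<le> norm1 w * e"
proof -
  have "norm v \<le> (\<Sum>j\<in>UNIV. \<bar>v $ j\<bar>)"
    by (rule norm_le_l1_cart)
  also have "\<dots> \<le> (\<Sum>j\<in>UNIV. \<bar>w $ j\<bar> * e)"
    using assms by (intro sum_mono) (meson abs_ge_self mult_right_mono order.trans)
  finally show ?thesis
    by (simp add: norm1_def sum_distrib_right)
qed

lemma omit_in_extensional: "omit j u \<in> extensional (- {j})"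
  by (simp add: omit_def)

lemma L2_set_omit_diff_le:
  "L2_set (\<lambda>i. omit j u i - omit j v i) (- {j}) \<le> norm (u - v :: real ^ 'm::finite)"
proof -
  have "L2_set (\<lambda>i. omit j u i - omit j v i) (- {j}) = L2_set (\<lambda>i. (u - v) $ i) (- {j})"
    by (intro L2_set_cong) (auto simp: omit_def)
  also have "\<dots> \<le> L2_set (\<lambda>i. (u - v) $ i) UNIV"
    unfolding L2_set_def by (intro real_sqrt_le_mono sum_mono2) auto
  finally show ?thesis
    by (simp add: norm_vec_def L2_set_def)
qed

text \<open>The vector with components \<open>\<psi> j (omit j u)\<close> is the translation that carries a fixed box to
  \<open>K(u)\<close>; this bound measures how much the constraint set moves with \<open>u\<close>.\<close>
lemma shift_lipschitz:
  fixes u v :: "real ^ 'm::finite"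
  assumes "\<And>j. lipschitz_omit j (l $ j) (\<psi> j)"
  shows "norm ((\<chi> j. \<psi> j (omit j u)) - (\<chi> j. \<psi> j (omit j v))) \<le> norm1 l * norm (u - v)"
proof (rule norm_le_norm1_mult)
  fix j
  have "\<bar>\<psi> j (omit j u) - \<psi> j (omit j v)\<bar>
      \<le> l $ j * L2_set (\<lambda>i. omit j u i - omit j v i) (- {j})"
    using assms[of j] omit_in_extensional unfolding lipschitz_omit_def by blast
  also have "\<dots> \<le> l $ j * norm (u - v)"
    using assms[of j] L2_set_omit_diff_le unfolding lipschitz_omit_def
    by (intro mult_left_mono) auto
  finally show "\<bar>((\<chi> j. \<psi> j (omit j u)) - (\<chi> j. \<psi> j (omit j v))) $ j\<bar> \<le> l $ j * norm (u - v)"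
    by simp
qed simp

text \<open>Two solutions \<open>u\<close>, \<open>v\<close> belong to constraint sets that differ by the translation \<open>\<delta>\<close>. Translating \<open>v\<close>
  back to \<open>w = v - \<delta>\<close> makes it a competitor for \<open>u\<close>, and \<open>u + \<delta>\<close> a competitor for \<open>v\<close>. The first
  inequality feeds pseudomonotonicity at \<open>(u, w)\<close>, giving \<open>\<eta> |w - u|\<^sup>2 \<le> F w x \<bullet> (w - u)\<close>; the second
  one allows \<open>F v y\<close> to be subtracted from \<open>F w x\<close>. What is left is
  \<open>\<eta> |w - u| \<le> \<Lambda> (|x - y| + |\<delta>|)\<close>, and since \<open>|\<delta>| \<le> \<kappa> |u - v|\<close>, the terms in \<open>|u - v|\<close> on the
  right can be absorbed as soon as \<open>(1 + \<Lambda>/\<eta>) \<kappa> < 1\<close>.\<close>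
lemma translated_vi_solutions_bound:
  fixes F :: "'u::real_inner \<Rightarrow> 'x::real_normed_vector \<Rightarrow> 'u"
  assumes pseudo: "\<And>x u v. F u x \<bullet> (v - u) \<ge> 0 \<Longrightarrow> F v x \<bullet> (v - u) \<ge> \<eta> * (norm (v - u))\<^sup>2"
    and lip: "\<And>x y u v. norm (F u x - F v y) \<le> \<Lambda> * (norm (x - y) + norm (u - v))"
    and pos: "\<eta> > 0" "\<Lambda> \<ge> 0"
    and shift: "norm \<delta> \<le> \<kappa> * norm (u - v)"
    and vi_u: "F u x \<bullet> (v - \<delta> - u) \<ge> 0"
    and vi_v: "F v y \<bullet> (u + \<delta> - v) \<ge> 0"
    and small: "(1 + \<Lambda> / \<eta>) * \<kappa> < 1"
  shows "norm (u - v) \<le> \<Lambda> / \<eta> / (1 - (1 + \<Lambda> / \<eta>) * \<kappa>) * norm (x - y)"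
proof -
  define w where "w = v - \<delta>"
  have "\<eta> * (norm (w - u))\<^sup>2 \<le> F w x \<bullet> (w - u)"
    using pseudo vi_u by (simp add: w_def)
  also have "\<dots> \<le> F w x \<bullet> (w - u) + F v y \<bullet> (u - w)"
    using vi_v by (simp add: w_def algebra_simps)
  also have "\<dots> = (F w x - F v y) \<bullet> (w - u)"
    by (simp add: inner_diff_left inner_diff_right)
  also have "\<dots> \<le> norm (F w x - F v y) * norm (w - u)"
    by (rule norm_cauchy_schwarz)
  also have "\<dots> \<le> \<Lambda> * (norm (x - y) + norm \<delta>) * norm (w - u)"
    using lip[of w x v y] by (intro mult_right_mono) (auto simp: w_def)
  finally have "norm (w - u) * (\<eta> * norm (w - u)) \<le> norm (w - u) * (\<Lambda> * (norm (x - y) + norm \<delta>))"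
    by (simp add: power2_eq_square mult_ac)
  moreover have "0 \<le> \<Lambda> * (norm (x - y) + norm \<delta>)"
    using pos by simp
  ultimately have "\<eta> * norm (w - u) \<le> \<Lambda> * (norm (x - y) + norm \<delta>)"
    by (cases "norm (w - u) = 0") (simp_all add: mult_le_cancel_left)
  hence "norm (w - u) \<le> \<Lambda> / \<eta> * (norm (x - y) + norm \<delta>)"
    using pos by (simp add: field_simps)
  moreover have "norm (u - v) \<le> norm (w - u) + norm \<delta>"
    using norm_triangle_ineq[of "w - u" "\<delta>"] by (simp add: w_def norm_minus_commute)
  ultimately have "norm (u - v) \<le> \<Lambda> / \<eta> * norm (x - y) + (1 + \<Lambda> / \<eta>) * norm \<delta>"
    by (simp add: algebra_simps)
  also have "\<dots> \<le> \<Lambda> / \<eta> * norm (x - y) + (1 + \<Lambda> / \<eta>) * (\<kappa> * norm (u - v))"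
    using shift pos by (intro add_left_mono mult_left_mono) auto
  finally have "norm (u - v) * (1 - (1 + \<Lambda> / \<eta>) * \<kappa>) \<le> \<Lambda> / \<eta> * norm (x - y)"
    by (simp add: algebra_simps)
  moreover have "0 < 1 - (1 + \<Lambda> / \<eta>) * \<kappa>"
    using small by simp
  ultimately have "norm (u - v) \<le> \<Lambda> / \<eta> * norm (x - y) / (1 - (1 + \<Lambda> / \<eta>) * \<kappa>)"
    by (subst pos_le_divide_eq)
  thus ?thesis
    by simp
qed

text \<open>Since the square root is at least \<open>\<eta>\<close>, the left-hand side of the smallness condition is at
  least \<open>((1 + \<Lambda>/\<eta>) \<kappa>)\<^sup>2\<close>.\<close>
lemma contraction_constant_less_1:
  fixes \<Lambda> \<eta> \<kappa> :: real
  assumes "\<Lambda> \<ge> 0" "\<eta> > 0" "\<kappa> \<ge> 0"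
    and "2 * (\<kappa>\<^sup>2 / \<eta>\<^sup>2) * (\<Lambda> * sqrt (4 * \<Lambda>\<^sup>2 + 2 * \<eta>\<^sup>2) + 2 * \<Lambda>\<^sup>2 + \<eta>\<^sup>2) < 1"
  shows "(1 + \<Lambda> / \<eta>) * \<kappa> < 1"
proof -
  define R where "R = \<Lambda> * sqrt (4 * \<Lambda>\<^sup>2 + 2 * \<eta>\<^sup>2) + 2 * \<Lambda>\<^sup>2 + \<eta>\<^sup>2"
  have "\<eta> \<le> sqrt (4 * \<Lambda>\<^sup>2 + 2 * \<eta>\<^sup>2)"
    using assms by (intro real_le_rsqrt) (smt (verit) zero_le_power2)
  hence "\<Lambda> * \<eta> \<le> \<Lambda> * sqrt (4 * \<Lambda>\<^sup>2 + 2 * \<eta>\<^sup>2)"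
    using assms by (intro mult_left_mono)
  hence "(\<Lambda> + \<eta>)\<^sup>2 \<le> 2 * R"
    using add_mono[OF _ add_mono[OF zero_le_power2[of \<Lambda>] zero_le_power2[of \<eta>]]]
    unfolding power2_sum R_def by (simp add: algebra_simps add_increasing)
  hence "\<kappa>\<^sup>2 / \<eta>\<^sup>2 * (\<Lambda> + \<eta>)\<^sup>2 \<le> \<kappa>\<^sup>2 / \<eta>\<^sup>2 * (2 * R)"
    by (intro mult_left_mono) auto
  also have "\<dots> = 2 * (\<kappa>\<^sup>2 / \<eta>\<^sup>2) * R"
    by simp
  also have "\<dots> < 1"
    using assms(4) by (simp only: R_def)
  also have "\<kappa>\<^sup>2 / \<eta>\<^sup>2 * (\<Lambda> + \<eta>)\<^sup>2 = ((1 + \<Lambda> / \<eta>) * \<kappa>)\<^sup>2"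
    using assms(2) by (simp add: field_simps power2_eq_square)
  finally show ?thesis
    by (simp add: abs_square_less_1)
qed

section \<open>The fractional kernel\<close>

lemma has_integral_powr_reflected:
  fixes a s :: real
  assumes "a > 0" "s \<ge> 0"
  shows "((\<lambda>\<zeta>. (s - \<zeta>) powr (a - 1)) has_integral s powr a / a) {0..s}"
proof -
  have "((\<lambda>x. x powr (a - 1)) has_integral s powr a / a) {0..s}"
    using has_integral_powr_from_0[of "a - 1" s] assms by simp
  hence "((\<lambda>x. (- x) powr (a - 1)) has_integral s powr a / a) {- s..0}"
    using has_integral_reflect_real[of "\<lambda>x. x powr (a - 1)" _ s 0] 
    by (metis add.inverse_neutral has_integral_reflect_lemma_real)
  from has_integral_affinity'[of "\<lambda>x. (- x) powr (a - 1)" _ "- s" 0 1 "- s"] this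
  show ?thesis by simp
qed

text \<open>The composition of two fractional kernels is again a fractional kernel: this is Euler's Beta
  integral moved from \<open>[0,1]\<close> to \<open>[r,s]\<close>.\<close>
lemma has_integral_Beta_kernel:
  fixes a b r s :: real
  assumes "a > 0" "b > 0" "r < s"
  shows "((\<lambda>\<zeta>. (s - \<zeta>) powr (a - 1) * (\<zeta> - r) powr (b - 1)) has_integral
           (Beta a b * (s - r) powr (a + b - 1))) {r..s}"
proof -
  define m where "m = 1 / (s - r)"
  have m: "m > 0" using assms by (simp add: m_def)
  have "((\<lambda>t. t powr (b - 1) * (1 - t) powr (a - 1)) has_integral Beta a b) (cbox 0 1)"
    using has_integral_Beta_real[of b a] assms by (simp add: Beta_commute)
  from has_integral_affinity'[OF this m, of "- (m * r)"]
  have "((\<lambda>x. (m * x - m * r) powr (b - 1) * (1 - (m * x - m * r)) powr (a - 1))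
        has_integral (Beta a b / m)) (cbox (m * r / m) ((1 + m * r) / m))"
    by (simp add: field_simps)
  also have "cbox (m * r / m) ((1 + m * r) / m) = {r..s}"
    using m by (simp add: add_divide_distrib) (simp add: m_def)
  finally have "((\<lambda>x. (m * x - m * r) powr (b - 1) * (1 - (m * x - m * r)) powr (a - 1))
        has_integral (Beta a b / m)) {r..s}" .
  hence "((\<lambda>x. (s - r) powr (a + b - 2) * ((m * x - m * r) powr (b - 1) * (1 - (m * x - m * r)) powr (a - 1)))
        has_integral ((s - r) powr (a + b - 2) * (Beta a b / m))) {r..s}"
    by (rule has_integral_mult_right)
  also have "(s - r) powr (a + b - 2) * (Beta a b / m) = Beta a b * (s - r) powr (a + b - 1)"
    using assms powr_add[of "s - r" "a + b - 2" 1] by (simp add: m_def)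
  finally show ?thesis
  proof (rule has_integral_eq[rotated])
    fix x assume x: "x \<in> {r..s}"
    have mx: "m * x - m * r = (x - r) / (s - r)"
      by (simp add: m_def diff_divide_distrib)
    moreover have "1 - (m * x - m * r) = (s - x) / (s - r)"
      using assms by (simp add: mx diff_divide_eq_iff)
    moreover have "(s - r) powr (a + b - 2) = (s - r) powr (b - 1) * (s - r) powr (a - 1)"
      by (simp flip: powr_add add: algebra_simps)
    ultimately show "(s - r) powr (a + b - 2) * ((m * x - m * r) powr (b - 1) * (1 - (m * x - m * r)) powr (a - 1))
        = (s - x) powr (a - 1) * (x - r) powr (b - 1)"
      using x assms by (simp add: powr_divide)
  qed
qed

lemma kernel_absolutely_integrable:
  fixes f :: "real \<Rightarrow> 'a::euclidean_space"
  assumes "a > 0" "s \<ge> 0" "continuous_on {0..s} f"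
  shows "(\<lambda>\<zeta>. (s - \<zeta>) powr (a - 1) *\<^sub>R f \<zeta>) absolutely_integrable_on {0..s}"
proof (rule absolutely_integrable_bounded_measurable_product[of "\<lambda>x c. c *\<^sub>R x" f])
  show "bilinear (\<lambda>(x::'a) c. c *\<^sub>R x)"
    by (simp add: bilinear_def linear_iff algebra_simps)
  show "f \<in> borel_measurable (lebesgue_on {0..s})"
    using assms by (intro continuous_imp_measurable_on_sets_lebesgue) auto
  show "bounded (f ` {0..s})"
    using assms by (intro compact_imp_bounded compact_continuous_image) auto
  show "(\<lambda>\<zeta>. (s - \<zeta>) powr (a - 1)) absolutely_integrable_on {0..s}"
    using has_integral_powr_reflected[OF assms(1,2)]
    by (subst absolutely_integrable_on_iff_nonneg) (auto simp: integrable_on_def)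
qed auto

text \<open>The Riemann-Liouville integral is a gauge integral, while Fubini's theorem is available for the
  Lebesgue integral over Borel measurable functions; this is the passage from one to the other.\<close>
lemma set_integrable_lborel:
  fixes f :: "real \<Rightarrow> 'a::euclidean_space"
  assumes "f absolutely_integrable_on S" "(\<lambda>x. indicator S x *\<^sub>R f x) \<in> borel_measurable borel"
  shows "set_integrable lborel S f"
  using assms(1) integrable_completion[of "\<lambda>x. indicator S x *\<^sub>R f x" lborel] assms(2)
  unfolding set_integrable_def by simp

lemma kernel_set_integrable:
  fixes f :: "real \<Rightarrow> 'a::euclidean_space"
  assumes "a > 0" "s \<ge> 0" "continuous_on {0..s} f"
  shows "set_integrable lborel {0..s} (\<lambda>\<zeta>. (s - \<zeta>) powr (a - 1) *\<^sub>R f \<zeta>)"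
proof (rule set_integrable_lborel)
  have [measurable]: "(\<lambda>x. indicator {0..s} x *\<^sub>R f x) \<in> borel_measurable borel"
    using assms by (intro borel_measurable_continuous_on_indicator) auto
  have "(\<lambda>x. (s - x) powr (a - 1) *\<^sub>R indicator {0..s} x *\<^sub>R f x) \<in> borel_measurable borel"
    by measurable
  thus "(\<lambda>x. indicat_real {0..s} x *\<^sub>R (s - x) powr (a - 1) *\<^sub>R f x) \<in> borel_measurable borel"
    by (simp add: mult.commute)
qed (rule kernel_absolutely_integrable[OF assms])

text \<open>Fubini on the triangle \<open>0 \<le> r \<le> \<zeta> \<le> s\<close>. Integrating first over \<open>\<zeta>\<close> gives the Beta kernel in
  closed form for the integrand and for its norm alike, so the same computation yields both absolute
  integrability and the value of the iterated integral.\<close>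
lemma fractional_kernel_Fubini:
  fixes f :: "real \<Rightarrow> 'a::euclidean_space"
  assumes a: "a > 0" and b: "b > 0" and s: "s \<ge> 0" and f: "continuous_on {0..s} f"
  shows "integral {0..s} (\<lambda>\<zeta>. (s - \<zeta>) powr (a - 1) *\<^sub>R
             integral {0..\<zeta>} (\<lambda>r. (\<zeta> - r) powr (b - 1) *\<^sub>R f r))
       = Beta a b *\<^sub>R integral {0..s} (\<lambda>r. (s - r) powr (a + b - 1) *\<^sub>R f r)"
proof -
  define g where "g = (\<lambda>r. indicator {0..s} r *\<^sub>R f r)"
  have g[measurable]: "g \<in> borel_measurable borel"
    unfolding g_def using f by (intro borel_measurable_continuous_on_indicator) auto
  \<comment> \<open>The first argument is the variable \<open>r\<close>, so that the inner integral is the explicit one.\<close>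
  define G where "G = (\<lambda>r \<zeta>. if 0 \<le> r \<and> r \<le> \<zeta> \<and> \<zeta> \<le> s
      then ((s - \<zeta>) powr (a - 1) * (\<zeta> - r) powr (b - 1)) *\<^sub>R g r else 0)"
  have G[measurable]: "case_prod G \<in> borel_measurable (lborel \<Otimes>\<^sub>M lborel)"
    unfolding G_def by measurable
  have Gr: "G r = (\<lambda>\<zeta>. indicator {r..s} \<zeta> *\<^sub>R (((s - \<zeta>) powr (a - 1) * (\<zeta> - r) powr (b - 1)) *\<^sub>R f r))"
    if "0 \<le> r" "r < s" for r
    using that by (auto simp: G_def g_def fun_eq_iff indicator_def)
  have G0: "G r = (\<lambda>\<zeta>. 0)" if "\<not> (0 \<le> r \<and> r < s)" for r
    using that by (cases "r = s") (auto simp: G_def g_def fun_eq_iff)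
  have k_int: "set_integrable lborel {r..s} (\<lambda>\<zeta>. (s - \<zeta>) powr (a - 1) * (\<zeta> - r) powr (b - 1))"
    if "r < s" for r
    using has_integral_Beta_kernel[OF a b that]
    by (intro set_integrable_lborel)
       (auto simp: absolutely_integrable_on_iff_nonneg integrable_on_def)
  have k_val: "(LINT \<zeta>:{r..s}|lborel. (s - \<zeta>) powr (a - 1) * (\<zeta> - r) powr (b - 1))
      = Beta a b * (s - r) powr (a + b - 1)" if "r < s" for r
    using set_borel_integral_eq_integral(2)[OF k_int[OF that]] has_integral_Beta_kernel[OF a b that]
    by (simp add: integral_unique)
  have G_int: "integrable lborel (G r)" for r
  proof (cases "0 \<le> r \<and> r < s")
    case True
    then show ?thesis
      using integrable_scaleR_left[OF k_int[of r, unfolded set_integrable_def], of "f r"]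
      by (simp add: Gr)
  next
    case False
    then show ?thesis by (simp add: G0)
  qed
  have G_val: "(\<integral>\<zeta>. G r \<zeta> \<partial>lborel)
      = Beta a b *\<^sub>R (indicator {0..s} r *\<^sub>R ((s - r) powr (a + b - 1) *\<^sub>R f r))" for r
  proof (cases "0 \<le> r \<and> r < s")
    case True
    have "(\<integral>\<zeta>. G r \<zeta> \<partial>lborel)
        = (LINT \<zeta>:{r..s}|lborel. (s - \<zeta>) powr (a - 1) * (\<zeta> - r) powr (b - 1)) *\<^sub>R f r"
      using True integral_scaleR_left[OF k_int[of r, unfolded set_integrable_def], of "f r"]
      by (simp add: Gr set_lebesgue_integral_def)
    then show ?thesis using True by (simp add: k_val)
  next
    case False
    then show ?thesis by (cases "r = s") (auto simp: G0)
  qed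
  have nG_val: "(\<integral>\<zeta>. norm (G r \<zeta>) \<partial>lborel) = norm (\<integral>\<zeta>. G r \<zeta> \<partial>lborel)" for r
  proof (cases "0 \<le> r \<and> r < s")
    case True
    have "(\<lambda>\<zeta>. norm (G r \<zeta>)) = (\<lambda>\<zeta>. (indicator {r..s} \<zeta> *\<^sub>R
        ((s - \<zeta>) powr (a - 1) * (\<zeta> - r) powr (b - 1))) * norm (f r))"
      using True by (auto simp: Gr fun_eq_iff indicator_def)
    hence "(\<integral>\<zeta>. norm (G r \<zeta>) \<partial>lborel)
        = (LINT \<zeta>:{r..s}|lborel. (s - \<zeta>) powr (a - 1) * (\<zeta> - r) powr (b - 1)) * norm (f r)"
      by (simp only: Bochner_Integration.integral_mult_left_zero set_lebesgue_integral_def)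
    moreover have "Beta a b \<ge> 0"
      using a b by (simp add: Beta_def Gamma_real_pos less_imp_le)
    ultimately show ?thesis using True by (simp add: k_val G_val)
  next
    case False
    then show ?thesis by (simp add: G0)
  qed
  have r_int: "set_integrable lborel {0..s} (\<lambda>r. (s - r) powr (a + b - 1) *\<^sub>R f r)"
    using kernel_set_integrable[of "a + b" s f] a b s f by simp
  have "integrable (lborel \<Otimes>\<^sub>M lborel) (case_prod G)"
  proof (rule lborel_pair.Fubini_integrable)
    show "integrable lborel (\<lambda>r. \<integral>\<zeta>. norm (case_prod G (r, \<zeta>)) \<partial>lborel)"
      unfolding case_prod_conv nG_val G_val
      using integrable_norm[OF integrable_scaleR_right[OF r_int[unfolded set_integrable_def], of "Beta a b"]]
      by simp
  qed (use G_int in auto)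
  from lborel_pair.Fubini_integral[OF this]
  have "(\<integral>\<zeta>. (\<integral>r. G r \<zeta> \<partial>lborel) \<partial>lborel) = (\<integral>r. (\<integral>\<zeta>. G r \<zeta> \<partial>lborel) \<partial>lborel)" .
  also have "\<dots> = Beta a b *\<^sub>R (LINT r:{0..s}|lborel. (s - r) powr (a + b - 1) *\<^sub>R f r)"
    unfolding G_val set_lebesgue_integral_def by (rule integral_scaleR_right)
  also have "\<dots> = Beta a b *\<^sub>R integral {0..s} (\<lambda>r. (s - r) powr (a + b - 1) *\<^sub>R f r)"
    using set_borel_integral_eq_integral(2)[OF r_int] by simp
  finally have *: "(\<integral>\<zeta>. (\<integral>r. G r \<zeta> \<partial>lborel) \<partial>lborel) = \<dots>" .
  have inner: "(\<integral>r. G r \<zeta> \<partial>lborel) = indicator {0..s} \<zeta> *\<^sub>R ((s - \<zeta>) powr (a - 1) *\<^sub>R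
             integral {0..\<zeta>} (\<lambda>r. (\<zeta> - r) powr (b - 1) *\<^sub>R f r))" for \<zeta>
  proof (cases "\<zeta> \<in> {0..s}")
    case True
    have i: "set_integrable lborel {0..\<zeta>} (\<lambda>r. (\<zeta> - r) powr (b - 1) *\<^sub>R f r)"
      using True f by (intro kernel_set_integrable b) (auto intro: continuous_on_subset)
    have "(\<lambda>r. G r \<zeta>) = (\<lambda>r. (s - \<zeta>) powr (a - 1) *\<^sub>R (indicator {0..\<zeta>} r *\<^sub>R ((\<zeta> - r) powr (b - 1) *\<^sub>R f r)))"
      using True by (auto simp: G_def g_def fun_eq_iff indicator_def)
    hence "(\<integral>r. G r \<zeta> \<partial>lborel) = (s - \<zeta>) powr (a - 1) *\<^sub>R (LINT r:{0..\<zeta>}|lborel. (\<zeta> - r) powr (b - 1) *\<^sub>R f r)"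
      unfolding set_lebesgue_integral_def by (simp only: integral_scaleR_right)
    thus ?thesis using True set_borel_integral_eq_integral(2)[OF i] by simp
  qed (auto simp: G_def intro!: integral_eq_zero_AE)
  have "set_integrable lborel {0..s} (\<lambda>\<zeta>. (s - \<zeta>) powr (a - 1) *\<^sub>R
             integral {0..\<zeta>} (\<lambda>r. (\<zeta> - r) powr (b - 1) *\<^sub>R f r))"
    unfolding set_integrable_def inner[symmetric]
    using lborel_pair.integrable_snd[OF \<open>integrable (lborel \<Otimes>\<^sub>M lborel) (case_prod G)\<close>] by simp
  from set_borel_integral_eq_integral(2)[OF this] * show ?thesis
    unfolding inner set_lebesgue_integral_def by simp
qed

section \<open>Riemann-Liouville integrals\<close>

lemma Gamma_nonzero: "a > 0 \<Longrightarrow> Gamma (a::real) \<noteq> 0"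
  using Gamma_real_pos[of a] by linarith

lemma rl_integral_pos_order:
  "a > 0 \<Longrightarrow> rl_integral a f s
     = (1 / Gamma a) *\<^sub>R integral {0..s} (\<lambda>\<zeta>. (s - \<zeta>) powr (a - 1) *\<^sub>R f \<zeta>)"
  by (simp add: rl_integral_def)

lemma rl_integral_at_0: "a > 0 \<Longrightarrow> rl_integral a f 0 = 0"
  by (simp add: rl_integral_pos_order)

text \<open>The kernel has exponent \<open>0\<close>, but \<open>0 powr 0 = 0\<close>, so it equals \<open>1\<close> only away from the end point \<open>s\<close>.\<close>
lemma rl_integral_1: "rl_integral 1 f s = integral {0..s} f"
proof -
  have "integral {0..s} (\<lambda>\<zeta>. (s - \<zeta>) powr (1 - 1) *\<^sub>R f \<zeta>) = integral {0..s} f"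
    by (rule integral_spike[of "{s}"]) auto
  thus ?thesis by (simp add: rl_integral_pos_order)
qed

lemma rl_integral_cong:
  assumes "a > 0" "\<And>\<zeta>. \<zeta> \<in> {0..s} \<Longrightarrow> f \<zeta> = g \<zeta>"
  shows "rl_integral a f s = rl_integral a g s"
  unfolding rl_integral_pos_order[OF assms(1)]
  by (intro arg_cong[where f = "(*\<^sub>R) _"] integral_cong) (simp add: assms(2))

lemma rl_integral_diff:
  fixes f g :: "real \<Rightarrow> 'a::euclidean_space"
  assumes "a > 0" "s \<ge> 0" "continuous_on {0..s} f" "continuous_on {0..s} g"
  shows "rl_integral a (\<lambda>\<zeta>. f \<zeta> - g \<zeta>) s = rl_integral a f s - rl_integral a g s"
proof -
  have "integral {0..s} (\<lambda>\<zeta>. (s - \<zeta>) powr (a - 1) *\<^sub>R (f \<zeta> - g \<zeta>))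
      = integral {0..s} (\<lambda>\<zeta>. (s - \<zeta>) powr (a - 1) *\<^sub>R f \<zeta>)
        - integral {0..s} (\<lambda>\<zeta>. (s - \<zeta>) powr (a - 1) *\<^sub>R g \<zeta>)"
    unfolding scaleR_diff_right using kernel_absolutely_integrable assms
    by (intro integral_diff) (blast intro: set_lebesgue_integral_eq_integral(1))+
  thus ?thesis
    unfolding rl_integral_pos_order[OF assms(1)] by (simp only: scaleR_diff_right)
qed

lemma rl_integral_semigroup:
  fixes f :: "real \<Rightarrow> 'a::euclidean_space"
  assumes "a > 0" "b > 0" "s \<ge> 0" "continuous_on {0..s} f"
  shows "rl_integral a (rl_integral b f) s = rl_integral (a + b) f s"
proof -
  have "integral {0..s} (\<lambda>\<zeta>. (s - \<zeta>) powr (a - 1) *\<^sub>R rl_integral b f \<zeta>)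
      = integral {0..s} (\<lambda>\<zeta>. (1 / Gamma b) *\<^sub>R ((s - \<zeta>) powr (a - 1) *\<^sub>R
          integral {0..\<zeta>} (\<lambda>r. (\<zeta> - r) powr (b - 1) *\<^sub>R f r)))"
    using assms by (intro integral_cong) (simp add: rl_integral_pos_order)
  also have "\<dots> = (1 / Gamma b) *\<^sub>R
      (Beta a b *\<^sub>R integral {0..s} (\<lambda>r. (s - r) powr (a + b - 1) *\<^sub>R f r))"
    by (simp only: integral_cmul fractional_kernel_Fubini[OF assms])
  finally show ?thesis
    using assms Gamma_nonzero[of a] Gamma_nonzero[of b] by (simp add: rl_integral_pos_order Beta_def)
qed

text \<open>Substituting \<open>\<zeta> = s\<sigma>\<close> makes the singular kernel and the interval independent of \<open>s\<close>; continuity in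
  \<open>s\<close> is then just uniform continuity of \<open>f\<close>.\<close>
lemma rl_integral_rescaled:
  fixes f :: "real \<Rightarrow> 'a::euclidean_space"
  assumes "a > 0" "s \<ge> 0" "continuous_on {0..s} f"
  shows "rl_integral a f s = (s powr a / Gamma a) *\<^sub>R
           integral {0..1} (\<lambda>\<sigma>. (1 - \<sigma>) powr (a - 1) *\<^sub>R f (s * \<sigma>))"
proof (cases "s = 0")
  case True
  then show ?thesis using assms by (simp add: rl_integral_at_0)
next
  case False
  with assms have s: "s > 0" by simp
  define I where "I = integral {0..s} (\<lambda>\<zeta>. (s - \<zeta>) powr (a - 1) *\<^sub>R f \<zeta>)"
  have "((\<lambda>\<zeta>. (s - \<zeta>) powr (a - 1) *\<^sub>R f \<zeta>) has_integral I) (cbox 0 s)"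
    unfolding I_def using kernel_absolutely_integrable[OF assms]
    by (simp add: integrable_integral set_lebesgue_integral_eq_integral(1))
  from has_integral_affinity'[OF this s, of 0] s
  have "((\<lambda>\<sigma>. (s - s * \<sigma>) powr (a - 1) *\<^sub>R f (s * \<sigma>)) has_integral (I /\<^sub>R s)) {0..1}"
    by simp
  from has_integral_cmul[OF this, of "s powr (1 - a)"]
  have "((\<lambda>\<sigma>. (1 - \<sigma>) powr (a - 1) *\<^sub>R f (s * \<sigma>)) has_integral
          (s powr (1 - a) *\<^sub>R (I /\<^sub>R s))) {0..1}"
  proof (rule has_integral_eq[rotated])
    fix \<sigma> :: real assume \<sigma>: "\<sigma> \<in> {0..1}"
    have "(s - s * \<sigma>) powr (a - 1) = s powr (a - 1) * (1 - \<sigma>) powr (a - 1)"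
      using \<sigma> s by (simp flip: powr_mult add: algebra_simps)
    moreover have "s powr (1 - a) * s powr (a - 1) = 1"
      using s by (simp flip: powr_add)
    ultimately show "s powr (1 - a) *\<^sub>R (s - s * \<sigma>) powr (a - 1) *\<^sub>R f (s * \<sigma>)
        = (1 - \<sigma>) powr (a - 1) *\<^sub>R f (s * \<sigma>)"
      by (simp flip: mult.assoc)
  qed
  hence "integral {0..1} (\<lambda>\<sigma>. (1 - \<sigma>) powr (a - 1) *\<^sub>R f (s * \<sigma>)) = (s powr (1 - a) / s) *\<^sub>R I"
    by (simp add: integral_unique divide_inverse)
  moreover have "s powr a * (s powr (1 - a) / s) = 1"
    using s powr_add[of s a "1 - a"] by simp
  ultimately show ?thesis
    using assms by (simp add: rl_integral_pos_order I_def)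
qed

lemma continuous_on_rl_integral:
  fixes f :: "real \<Rightarrow> 'a::euclidean_space"
  assumes a: "a > 0" and f: "continuous_on {0..T} f"
  shows "continuous_on {0..T} (rl_integral a f)"
proof -
  define J where "J = (\<lambda>s. integral {0..1} (\<lambda>\<sigma>. (1 - \<sigma>) powr (a - 1) *\<^sub>R f (s * \<sigma>)))"
  have scaled: "continuous_on {0..1} (\<lambda>\<sigma>. f (s * \<sigma>))" if "s \<in> {0..T}" for s
    using that by (intro continuous_on_compose2[OF f] continuous_intros)
      (auto intro: order_trans[OF mult_left_le])
  have int: "(\<lambda>\<sigma>. (1 - \<sigma>) powr (a - 1) *\<^sub>R f (s * \<sigma>)) integrable_on {0..1}" if "s \<in> {0..T}" for s
    using kernel_absolutely_integrable[OF a _ scaled[OF that]]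
    by (auto intro: set_lebesgue_integral_eq_integral(1))
  have ker: "((\<lambda>\<sigma>. (1 - \<sigma>) powr (a - 1)) has_integral 1 / a) {0..1}"
    using has_integral_powr_reflected[of a 1] a by simp
  \<comment> \<open>The kernel has total mass \<open>1/a\<close>, so a modulus of continuity \<open>e a/2\<close> of \<open>f\<close> costs only \<open>e/2\<close>.\<close>
  have "continuous_on {0..T} J"
    unfolding continuous_on_iff
  proof (intro ballI allI impI)
    fix s e :: real assume s: "s \<in> {0..T}" and e: "e > 0"
    have "uniformly_continuous_on {0..T} f"
      using f by (intro compact_uniformly_continuous) auto
    then obtain d where d: "d > 0"
      "\<And>x y. x \<in> {0..T} \<Longrightarrow> y \<in> {0..T} \<Longrightarrow> dist y x < d \<Longrightarrow> dist (f y) (f x) < e * a / 2"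
      unfolding uniformly_continuous_on_def using e a by (metis mult_pos_pos half_gt_zero)
    show "\<exists>d>0. \<forall>s'\<in>{0..T}. dist s' s < d \<longrightarrow> dist (J s') (J s) < e"
    proof (intro exI[of _ d] conjI ballI impI d(1))
      fix s' assume s': "s' \<in> {0..T}" "dist s' s < d"
      have J_diff: "J s' - J s = integral {0..1} (\<lambda>\<sigma>. (1 - \<sigma>) powr (a - 1) *\<^sub>R f (s' * \<sigma>) - (1 - \<sigma>) powr (a - 1) *\<^sub>R f (s * \<sigma>))"
        unfolding J_def using int s s' by (intro integral_diff[symmetric]) auto
      have "norm (J s' - J s) \<le> integral {0..1} (\<lambda>\<sigma>. (1 - \<sigma>) powr (a - 1) * (e * a / 2))"
        unfolding J_diff
      proof (rule integral_norm_bound_integral)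
        show "(\<lambda>\<sigma>. (1 - \<sigma>) powr (a - 1) *\<^sub>R f (s' * \<sigma>) - (1 - \<sigma>) powr (a - 1) *\<^sub>R f (s * \<sigma>)) integrable_on {0..1}"
          using int s s' by (intro integrable_diff) auto
        show "(\<lambda>\<sigma>. (1 - \<sigma>) powr (a - 1) * (e * a / 2)) integrable_on {0..1}"
          using has_integral_mult_left[OF ker, of "e * a / 2"] by blast
        fix \<sigma> :: real assume \<sigma>: "\<sigma> \<in> {0..1}"
        have "s * \<sigma> \<in> {0..T}" "s' * \<sigma> \<in> {0..T}"
          using \<sigma> s s' by (auto intro: order_trans[OF mult_left_le])
        moreover have "dist (s' * \<sigma>) (s * \<sigma>) < d"
        proof -
          have "dist (s' * \<sigma>) (s * \<sigma>) = dist s' s * \<sigma>"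
            using \<sigma> by (simp add: dist_real_def abs_mult flip: left_diff_distrib)
          also have "\<dots> \<le> dist s' s" using \<sigma> by (intro mult_left_le) auto
          finally show ?thesis using s' by simp
        qed
        ultimately have "norm (f (s' * \<sigma>) - f (s * \<sigma>)) \<le> e * a / 2"
          using d(2) by (force simp: dist_norm)
        hence "(1 - \<sigma>) powr (a - 1) * norm (f (s' * \<sigma>) - f (s * \<sigma>)) \<le> (1 - \<sigma>) powr (a - 1) * (e * a / 2)"
          by (intro mult_left_mono) auto
        thus "norm ((1 - \<sigma>) powr (a - 1) *\<^sub>R f (s' * \<sigma>) - (1 - \<sigma>) powr (a - 1) *\<^sub>R f (s * \<sigma>))
            \<le> (1 - \<sigma>) powr (a - 1) * (e * a / 2)"
          by (simp flip: scaleR_diff_right)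
      qed
      also have "\<dots> = e / 2"
        by (subst integral_unique[OF has_integral_mult_left[OF ker]]) (use a in simp)
      also have "\<dots> < e" using e by simp
      finally show "dist (J s') (J s) < e" by (simp add: dist_norm)
    qed
  qed
  hence "continuous_on {0..T} (\<lambda>s. (s powr a / Gamma a) *\<^sub>R J s)"
    using a Gamma_nonzero[of a] by (intro continuous_intros continuous_on_powr') auto
  moreover have "rl_integral a f s = (s powr a / Gamma a) *\<^sub>R J s" if "s \<in> {0..T}" for s
    unfolding J_def using that a f
    by (intro rl_integral_rescaled) (auto intro: continuous_on_subset)
  ultimately show ?thesis
    by (subst continuous_on_cong[OF refl]) auto
qed

section \<open>Inversion of the Caputo derivative\<close>

lemma eq_0_if_integrals_0:
  fixes f :: "real \<Rightarrow> 'a::euclidean_space"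
  assumes "continuous_on {0..T} f" "\<And>s. s \<in> {0..T} \<Longrightarrow> integral {0..s} f = 0" "0 < T" "s \<in> {0..T}"
  shows "f s = 0"
proof -
  have der: "((\<lambda>u. integral {0..u} f) has_vector_derivative f s) (at s within {0..T})"
    using assms by (intro integral_has_vector_derivative)
  have "((\<lambda>u. 0) has_vector_derivative f s) (at s within {0..T})"
    by (rule has_vector_derivative_transform[OF assms(4) _ der]) (use assms(2) in auto)
  moreover have "((\<lambda>u. 0) has_vector_derivative (0::'a)) (at s within {0..T})"
    by simp
  ultimately show ?thesis
    using assms vector_derivative_unique_within_closed_interval[of 0 T s "\<lambda>u. 0" "f s" 0] by simp
qed

text \<open>Write \<open>I\<^sup>a\<close> for the Riemann-Liouville integral of order \<open>a\<close> and \<open>w = z - z 0\<close>. The hypothesis integrates to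
  \<open>I\<^bsup>1-q\<^esup> w = I\<^sup>1 y = I\<^bsup>1-q\<^esup> I\<^sup>q y\<close>. Hence \<open>f = w - I\<^sup>q y\<close> satisfies \<open>I\<^bsup>1-q\<^esup> f = 0\<close>, and applying \<open>I\<^sup>q\<close>
  gives \<open>I\<^sup>1 f = 0\<close>, that is \<open>f = 0\<close>, since \<open>f\<close> is continuous. Arguing with \<open>f\<close> uses the semigroup
  law only for orders that add up to \<open>1\<close>. This needs \<open>q < 1\<close>; for \<open>q = 1\<close> the claim is the fundamental theorem of calculus.\<close>
lemma caputo_derivative_imp_integral_equation:
  fixes z y :: "real \<Rightarrow> 'a::euclidean_space"
  assumes T: "T > 0" and q: "0 < q" "q \<le> 1"
    and z: "continuous_on {0..T} z" and y: "continuous_on {0..T} y"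
    and der: "has_caputo_derivative_on q T z y" and s: "s \<in> {0..T}"
  shows "z s = z 0 + rl_integral q y s"
proof -
  define w where "w = (\<lambda>\<zeta>. z \<zeta> - z 0)"
  have w: "continuous_on {0..T} w"
    unfolding w_def by (intro continuous_intros z)
  have w0: "rl_integral (1 - q) w 0 = 0"
    using q by (cases "q = 1") (simp_all add: rl_integral_at_0 w_def, simp add: rl_integral_def)
  have P: "rl_integral (1 - q) w u = rl_integral 1 y u" if "u \<in> {0..T}" for u
  proof -
    have "(y has_integral (rl_integral (1 - q) w u - rl_integral (1 - q) w 0)) {0..u}"
    proof (rule fundamental_theorem_of_calculus)
      fix x assume "x \<in> {0..u}"
      with der that have "(rl_integral (1 - q) w has_vector_derivative y x) (at x within {0..T})"
        by (auto simp: has_caputo_derivative_on_def w_def)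
      thus "(rl_integral (1 - q) w has_vector_derivative y x) (at x within {0..u})"
        by (rule has_vector_derivative_within_subset) (use that in auto)
    qed (use that in auto)
    thus ?thesis using w0 by (simp add: rl_integral_1 integral_unique)
  qed
  have "w s = rl_integral q y s"
  proof (cases "q = 1")
    case True
    then show ?thesis using P[OF s] by (simp add: rl_integral_def[of 0])
  next
    case False
    with q have q1: "1 - q > 0" by simp
    define f where "f = (\<lambda>\<zeta>. w \<zeta> - rl_integral q y \<zeta>)"
    have qy: "continuous_on {0..T} (rl_integral q y)"
      using q y by (intro continuous_on_rl_integral)
    have f: "continuous_on {0..T} f"
      unfolding f_def by (intro continuous_intros w qy)
    have sub: "continuous_on {0..u} g" if "continuous_on {0..T} g" "u \<in> {0..T}" 
      for u and g :: "real \<Rightarrow> 'a"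
      using that by (auto intro: continuous_on_subset)
    have f0: "rl_integral (1 - q) f u = 0" if u: "u \<in> {0..T}" for u
    proof -
      have "rl_integral (1 - q) f u = rl_integral (1 - q) w u - rl_integral (1 - q) (rl_integral q y) u"
        unfolding f_def using u q1 by (intro rl_integral_diff sub[OF w] sub[OF qy]) auto
      also have "rl_integral (1 - q) (rl_integral q y) u = rl_integral (1 - q + q) y u"
        using u q q1 by (intro rl_integral_semigroup sub[OF y]) auto
      finally show ?thesis using P[OF u] by simp
    qed
    have "integral {0..u} f = 0" if u: "u \<in> {0..T}" for u
    proof -
      have "integral {0..u} f = rl_integral (q + (1 - q)) f u"
        by (simp add: rl_integral_1)
      also have "\<dots> = rl_integral q (rl_integral (1 - q) f) u"
        using u q q1 by (intro rl_integral_semigroup[symmetric] sub[OF f]) auto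
      also have "\<dots> = rl_integral q (\<lambda>_. 0) u"
        using u q by (intro rl_integral_cong) (auto simp: f0)
      finally show ?thesis using q by (simp add: rl_integral_pos_order)
    qed
    from eq_0_if_integrals_0[OF f this T s] show ?thesis by (simp add: f_def)
  qed
  thus ?thesis by (simp add: w_def algebra_simps)
qed

section \<open>A fractional Gronwall inequality\<close>

text \<open>After the substitution \<open>t = \<rho> (s - \<zeta>)\<close> the integral is an incomplete Gamma integral.\<close>
lemma has_integral_weighted_kernel_le:
  fixes q \<rho> s :: real
  assumes "q > 0" "\<rho> > 0" "s \<ge> 0"
  obtains I where "((\<lambda>\<zeta>. (s - \<zeta>) powr (q - 1) * exp (\<rho> * \<zeta>)) has_integral I) {0..s}"
    and "I \<le> Gamma q * exp (\<rho> * s) / \<rho> powr q"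
proof -
  define h where "h = (\<lambda>t::real. t powr (q - 1) / exp t)"
  have G: "(h has_integral Gamma q) {0..}"
    unfolding h_def by (rule Gamma_integral_real[OF assms(1)])
  have h: "h integrable_on {0..\<rho> * s}"
  proof -
    have "h absolutely_integrable_on {0..}"
      using G by (subst absolutely_integrable_on_iff_nonneg) (auto simp: h_def integrable_on_def)
    hence "h absolutely_integrable_on {0..\<rho> * s}"
      by (rule set_integrable_subset) auto
    thus ?thesis by (rule set_lebesgue_integral_eq_integral(1))
  qed
  define J where "J = integral {0..\<rho> * s} h"
  have J: "(h has_integral J) {0..\<rho> * s}"
    unfolding J_def using h by (rule integrable_integral)
  have "J \<le> Gamma q"
    by (rule has_integral_subset_le[OF _ J G]) (auto simp: h_def)
  have "((\<lambda>t. h (- t)) has_integral J) (cbox (- (\<rho> * s)) 0)"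
    using has_integral_reflect_lemma_real[OF J] by simp
  from has_integral_affinity'[OF this assms(2), of "- (\<rho> * s)"] assms(2)
  have "((\<lambda>\<zeta>. h (\<rho> * s - \<rho> * \<zeta>)) has_integral (J / \<rho>)) {0..s}"
    by (simp add: field_simps)
  from has_integral_mult_right[OF this, of "exp (\<rho> * s) / \<rho> powr (q - 1)"]
  have "((\<lambda>\<zeta>. (s - \<zeta>) powr (q - 1) * exp (\<rho> * \<zeta>)) has_integral
      (exp (\<rho> * s) / \<rho> powr (q - 1) * (J / \<rho>))) {0..s}"
  proof (rule has_integral_eq[rotated])
    fix \<zeta> assume "\<zeta> \<in> {0..s}"
    hence "(\<rho> * s - \<rho> * \<zeta>) powr (q - 1) = \<rho> powr (q - 1) * (s - \<zeta>) powr (q - 1)"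
      using assms by (simp flip: powr_mult right_diff_distrib)
    thus "exp (\<rho> * s) / \<rho> powr (q - 1) * h (\<rho> * s - \<rho> * \<zeta>) = (s - \<zeta>) powr (q - 1) * exp (\<rho> * \<zeta>)"
      using assms by (simp add: h_def exp_diff)
  qed
  also have "exp (\<rho> * s) / \<rho> powr (q - 1) * (J / \<rho>) = J * exp (\<rho> * s) / \<rho> powr q"
    using assms powr_add[of \<rho> "q - 1" 1] by simp
  finally show ?thesis
    by (rule that) (use \<open>J \<le> Gamma q\<close> assms in \<open>auto intro!: divide_right_mono mult_right_mono\<close>)
qed

text \<open>The point of the exponential weight is the factor \<open>1/\<rho>\<^sup>q\<close>: in the norm weighted by \<open>exp (-\<rho> s)\<close>,
  fractional integration is as small as desired for large \<open>\<rho>\<close>.\<close>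
lemma rl_integral_exp_bound:
  fixes g :: "real \<Rightarrow> 'a::euclidean_space"
  assumes "q > 0" "\<rho> > 0" "s \<ge> 0" "continuous_on {0..s} g"
    and g: "\<And>\<zeta>. \<zeta> \<in> {0..s} \<Longrightarrow> norm (g \<zeta>) \<le> C * exp (\<rho> * \<zeta>)"
  shows "norm (rl_integral q g s) \<le> C * exp (\<rho> * s) / \<rho> powr q"
proof -
  obtain I where I: "((\<lambda>\<zeta>. (s - \<zeta>) powr (q - 1) * exp (\<rho> * \<zeta>)) has_integral I) {0..s}"
    "I \<le> Gamma q * exp (\<rho> * s) / \<rho> powr q"
    using has_integral_weighted_kernel_le[OF assms(1-3)] by blast
  have "0 \<le> norm (g 0)" by simp
  also have "\<dots> \<le> C" using g[of 0] assms(3) by simp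
  finally have C: "C \<ge> 0" .
  have "norm (integral {0..s} (\<lambda>\<zeta>. (s - \<zeta>) powr (q - 1) *\<^sub>R g \<zeta>))
      \<le> integral {0..s} (\<lambda>\<zeta>. C * ((s - \<zeta>) powr (q - 1) * exp (\<rho> * \<zeta>)))"
  proof (rule integral_norm_bound_integral)
    show "(\<lambda>\<zeta>. (s - \<zeta>) powr (q - 1) *\<^sub>R g \<zeta>) integrable_on {0..s}"
      using kernel_absolutely_integrable[OF assms(1,3,4)] by (rule set_lebesgue_integral_eq_integral(1))
    show "(\<lambda>\<zeta>. C * ((s - \<zeta>) powr (q - 1) * exp (\<rho> * \<zeta>))) integrable_on {0..s}"
      using has_integral_mult_right[OF I(1)] by (rule has_integral_integrable)
    fix \<zeta> assume "\<zeta> \<in> {0..s}"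
    hence "(s - \<zeta>) powr (q - 1) * norm (g \<zeta>) \<le> (s - \<zeta>) powr (q - 1) * (C * exp (\<rho> * \<zeta>))"
      by (intro mult_left_mono g) auto
    thus "norm ((s - \<zeta>) powr (q - 1) *\<^sub>R g \<zeta>) \<le> C * ((s - \<zeta>) powr (q - 1) * exp (\<rho> * \<zeta>))"
      by (simp add: mult_ac)
  qed
  also have "\<dots> = C * I"
    by (rule integral_unique[OF has_integral_mult_right[OF I(1)]])
  also have "\<dots> \<le> C * (Gamma q * exp (\<rho> * s) / \<rho> powr q)"
    by (intro mult_left_mono I(2) C)
  finally have *: "norm (integral {0..s} (\<lambda>\<zeta>. (s - \<zeta>) powr (q - 1) *\<^sub>R g \<zeta>))
      \<le> Gamma q * (C * exp (\<rho> * s) / \<rho> powr q)"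
    by (simp add: mult_ac)
  have "norm (rl_integral q g s) = norm (integral {0..s} (\<lambda>\<zeta>. (s - \<zeta>) powr (q - 1) *\<^sub>R g \<zeta>)) / Gamma q"
    using Gamma_real_pos[OF assms(1)] by (simp add: rl_integral_pos_order[OF assms(1)])
  also have "\<dots> \<le> C * exp (\<rho> * s) / \<rho> powr q"
    using * Gamma_real_pos[OF assms(1)] by (subst pos_divide_le_eq) (simp_all add: mult.commute)
  finally show ?thesis .
qed

text \<open>With \<open>\<rho>\<^sup>q = 2 M\<close>, fractional integration followed by multiplication by \<open>M\<close> has norm at most \<open>1/2\<close> in
  the weighted sup norm on \<open>[0,s]\<close>, so half of the weighted maximum \<open>W\<close> of \<open>|h|\<close> can be absorbed. Working
  on \<open>[0,s]\<close> rather than \<open>[0,T]\<close>, together with the monotonicity of \<open>\<phi>\<close>, is what makes the bound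
  proportional to \<open>\<phi> s\<close>.\<close>
lemma fractional_Gronwall:
  fixes g h :: "real \<Rightarrow> 'a::euclidean_space"
  assumes q: "q > 0" and M: "M > 0"
    and g: "continuous_on {0..T} g"
    and h: "\<And>s. s \<in> {0..T} \<Longrightarrow> h s = rl_integral q g s"
    and le: "\<And>s. s \<in> {0..T} \<Longrightarrow> norm (g s) \<le> \<phi> s + M * norm (h s)"
    and \<phi>: "\<And>s. s \<in> {0..T} \<Longrightarrow> 0 \<le> \<phi> s" "mono_on {0..T} \<phi>"
    and s: "s \<in> {0..T}"
  shows "norm (h s) \<le> exp ((2 * M) powr (1 / q) * T) / M * \<phi> s"
proof -
  define \<rho> where "\<rho> = (2 * M) powr (1 / q)"
  have \<rho>: "\<rho> > 0" "\<rho> powr q = 2 * M"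
    using q M by (simp_all add: \<rho>_def powr_powr)
  have sub: "{0..u} \<subseteq> {0..T}" if "u \<in> {0..s}" for u using that s by auto
  have "continuous_on {0..T} h"
    using continuous_on_rl_integral[OF q g] by (subst continuous_on_cong[OF refl h]) auto
  hence "continuous_on {0..s} (\<lambda>\<zeta>. norm (h \<zeta>) / exp (\<rho> * \<zeta>))"
    using s by (intro continuous_intros) (auto intro: continuous_on_subset)
  then obtain u where u: "u \<in> {0..s}"
    and u_max: "\<And>\<zeta>. \<zeta> \<in> {0..s} \<Longrightarrow> norm (h \<zeta>) / exp (\<rho> * \<zeta>) \<le> norm (h u) / exp (\<rho> * u)"
    using continuous_attains_sup[of "{0..s}" "\<lambda>\<zeta>. norm (h \<zeta>) / exp (\<rho> * \<zeta>)"] s by auto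
  define W where "W = norm (h u) / exp (\<rho> * u)"
  have W: "norm (h \<zeta>) \<le> W * exp (\<rho> * \<zeta>)" if "\<zeta> \<in> {0..s}" for \<zeta>
    using u_max[OF that] by (simp add: W_def pos_divide_le_eq)
  have "norm (h u) \<le> (\<phi> s + M * W) * exp (\<rho> * u) / \<rho> powr q"
  proof -
    have "norm (rl_integral q g u) \<le> (\<phi> s + M * W) * exp (\<rho> * u) / \<rho> powr q"
    proof (rule rl_integral_exp_bound[OF q \<rho>(1)])
      fix \<zeta> assume "\<zeta> \<in> {0..u}"
      with u s have \<zeta>: "\<zeta> \<in> {0..T}" "\<zeta> \<in> {0..s}" by auto
      have "norm (g \<zeta>) \<le> \<phi> \<zeta> + M * norm (h \<zeta>)" by (rule le[OF \<zeta>(1)])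
      also have "\<dots> \<le> \<phi> s * exp (\<rho> * \<zeta>) + M * (W * exp (\<rho> * \<zeta>))"
      proof (intro add_mono mult_left_mono W[OF \<zeta>(2)])
        have "\<phi> \<zeta> \<le> \<phi> s" using \<zeta> s by (intro mono_onD[OF \<phi>(2)]) auto
        also have "\<phi> s * 1 \<le> \<phi> s * exp (\<rho> * \<zeta>)"
          using \<zeta> \<rho> \<phi>(1)[OF s] by (intro mult_left_mono) auto
        finally show "\<phi> \<zeta> \<le> \<phi> s * exp (\<rho> * \<zeta>)" by simp
      qed (use M in simp)
      finally show "norm (g \<zeta>) \<le> (\<phi> s + M * W) * exp (\<rho> * \<zeta>)"
        by (simp add: algebra_simps)
    qed (use u in \<open>auto intro: continuous_on_subset[OF g sub]\<close>)
    thus ?thesis using h[of u] u s by simp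
  qed
  hence "W * exp (\<rho> * u) \<le> (\<phi> s + M * W) / (2 * M) * exp (\<rho> * u)"
    by (simp add: W_def \<rho>(2))
  hence "W \<le> (\<phi> s + M * W) / (2 * M)"
    by (rule mult_right_le_imp_le) simp
  hence W_le: "W \<le> \<phi> s / M" using M by (simp add: field_simps)
  have "norm (h s) \<le> W * exp (\<rho> * s)" using s by (intro W) auto
  also have "\<dots> \<le> \<phi> s / M * exp (\<rho> * T)"
    using W_le s \<rho> M \<phi>(1)[OF s] by (intro mult_mono) auto
  finally show ?thesis by (simp add: \<rho>_def mult_ac)
qed

section \<open>The Mittag-Leffler function is at least one\<close>

text \<open>Keep only the part \<open>t \<ge> R\<close> of Euler's integral, where \<open>t powr (x - 1) \<ge> R powr (x - 1)\<close>. Since \<open>R\<close> is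
  arbitrary, the Gamma function outgrows every exponential.\<close>
lemma Gamma_lower_bound:
  fixes x R :: real
  assumes "x \<ge> 1" "R > 0"
  shows "R powr (x - 1) / exp R \<le> Gamma x"
proof -
  define k where "k = (\<lambda>t::real. if t \<in> {R..} then R powr (x - 1) * exp (- t) else 0)"
  have e: "((\<lambda>t. exp (-1 * t)) has_integral exp (-1 * R) / 1) {R..}"
    by (rule has_integral_exp_minus_to_infinity) simp
  have "((\<lambda>t. R powr (x - 1) * exp (- t)) has_integral (R powr (x - 1) * exp (- R))) {R..}"
    using has_integral_mult_right[OF e, of "R powr (x - 1)"] by simp
  hence "(k has_integral (R powr (x - 1) * exp (- R))) {0..}"
    unfolding k_def using assms by (subst has_integral_restrict) auto
  moreover have "((\<lambda>t. t powr (x - 1) / exp t) has_integral Gamma x) {0..}"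
    using assms by (intro Gamma_integral_real) simp
  moreover have "k t \<le> t powr (x - 1) / exp t" if "t \<in> {0..}" for t
    using that assms powr_mono2[of "x - 1" R t]
    by (auto simp: k_def exp_minus divide_inverse intro!: mult_right_mono)
  ultimately have "R powr (x - 1) * exp (- R) \<le> Gamma x"
    by (rule has_integral_le)
  thus ?thesis by (simp add: exp_minus divide_inverse)
qed

lemma mittag_leffler_summable:
  fixes q s :: real
  assumes q: "q > 0" and s: "s \<ge> 0"
  shows "summable (\<lambda>n. s ^ n / Gamma (real n * q + 1))"
proof (rule summable_comparison_test)
  \<comment> \<open>Chosen so that the terms are dominated by the powers of \<open>s / R powr q < 1/2\<close>.\<close>
  define R where "R = (2 * s + 1) powr (1 / q)"
  have R: "R > 0" "R powr q = 2 * s + 1"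
    using q s by (simp_all add: R_def powr_powr)
  show "\<exists>N. \<forall>n\<ge>N. norm (s ^ n / Gamma (real n * q + 1)) \<le> exp R * (1 / 2) ^ n"
  proof (intro exI[of _ 0] allI impI)
    fix n
    have "0 < R powr (real n * q) / exp R" using R by simp
    moreover have le: "R powr (real n * q) / exp R \<le> Gamma (real n * q + 1)"
      using Gamma_lower_bound[of "real n * q + 1" R] q R by simp
    ultimately have G: "Gamma (real n * q + 1) > 0" by linarith
    have "R powr (real n * q) = (R powr q) powr real n"
      by (simp add: powr_powr mult.commute)
    hence pw: "R powr (real n * q) = (2 * s + 1) ^ n"
      using s by (simp only: R(2) powr_realpow)
    have "norm (s ^ n / Gamma (real n * q + 1)) = s ^ n / Gamma (real n * q + 1)"
      using G s by simp
    also have "\<dots> \<le> s ^ n / (R powr (real n * q) / exp R)"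
      using le G s R by (intro divide_left_mono) auto
    also have "\<dots> = exp R * (s / (2 * s + 1)) ^ n"
      by (simp add: pw power_divide)
    also have "\<dots> \<le> exp R * (1 / 2) ^ n"
      using s by (intro mult_left_mono power_mono) (auto simp: field_simps)
    finally show "norm (s ^ n / Gamma (real n * q + 1)) \<le> exp R * (1 / 2) ^ n" .
  qed
  show "summable (\<lambda>n. exp R * (1 / 2) ^ n)"
    by (intro summable_mult summable_geometric) simp
qed

lemma mittag_leffler_ge_1:
  assumes "q > 0" "s \<ge> 0"
  shows "mittag_leffler q s \<ge> 1"
proof -
  have "(\<Sum>n\<in>{0}. s ^ n / Gamma (real n * q + 1)) \<le> mittag_leffler q s"
    unfolding mittag_leffler_def using assms
    by (intro sum_le_suminf mittag_leffler_summable divide_nonneg_pos zero_le_power Gamma_real_pos)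
       (auto intro: add_nonneg_pos)
  thus ?thesis by simp
qed

section \<open>Stability\<close>

text \<open>This is the bound for variational inequalities over translated sets, applied to \<open>F = S - D\<close> with
  \<open>\<Lambda> = norm1 lS + norm1 lD\<close> and with \<open>\<delta>\<close> the displacement between \<open>K(u)\<close> and \<open>K(v)\<close>. It makes the price
  a Lipschitz function of the state.\<close>
lemma solves_qvi_lipschitz:
  fixes S D :: "real ^ 'm::finite \<Rightarrow> real ^ 'n::finite \<Rightarrow> real ^ 'm"
    and a b \<psi> :: "'m \<Rightarrow> ('m \<Rightarrow> real) \<Rightarrow> real"
    and l lS lD :: "real ^ 'm" and \<eta> :: real
  defines "r \<equiv> (norm1 lS + norm1 lD) / \<eta>"
  assumes \<eta>: "\<eta> > 0"
    and mono: "\<And>x u1 u2.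
        (\<Sum>j\<in>UNIV. S u1 x $ j * (u2 $ j - u1 $ j))
          + (\<Sum>j\<in>UNIV. D u1 x $ j * (u1 $ j - u2 $ j)) \<ge> 0 \<Longrightarrow>
        (\<Sum>j\<in>UNIV. S u2 x $ j * (u2 $ j - u1 $ j))
          + (\<Sum>j\<in>UNIV. D u2 x $ j * (u1 $ j - u2 $ j)) \<ge> \<eta> * (norm (u2 - u1))^2"
    and lip_S: "\<And>x1 x2 u1 u2 j.
        \<bar>S u1 x1 $ j - S u2 x2 $ j\<bar> \<le> lS $ j * (norm (x1 - x2) + norm (u1 - u2))"
    and lip_D: "\<And>x1 x2 u1 u2 j.
        \<bar>D u1 x1 $ j - D u2 x2 $ j\<bar> \<le> lD $ j * (norm (x1 - x2) + norm (u1 - u2))"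
    and bounds: "\<And>j w. w \<in> extensional (- {j}) \<Longrightarrow> a j w = \<psi> j w + c j"
        "\<And>j w. w \<in> extensional (- {j}) \<Longrightarrow> b j w = \<psi> j w + d j"
    and lip: "\<And>j. lipschitz_omit j (l $ j) (\<psi> j)"
    and small: "(1 + r) * norm1 l < 1"
    and sol: "solves_qvi S D a b x u" "solves_qvi S D a b y v"
  shows "norm (u - v) \<le> r / (1 - (1 + r) * norm1 l) * norm (x - y)"
proof -
  define F where "F = (\<lambda>u x. S u x - D u x)"
  define p where "p = (\<lambda>u. \<chi> j. \<psi> j (omit j u))"
  \<comment> \<open>Membership in the price set means membership of \<open>w - p u\<close> in a box that does not depend on \<open>u\<close>.\<close>
  have price_set: "w \<in> price_set a b u \<longleftrightarrow> (\<forall>j. c j \<le> (w - p u) $ j \<and> (w - p u) $ j \<le> d j)" for u w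
    unfolding price_set_def p_def
    by (auto simp: bounds[OF omit_in_extensional] algebra_simps)
  have F_inner: "F u x \<bullet> (v - w) = (\<Sum>j\<in>UNIV. S u x $ j * (v $ j - w $ j))
      + (\<Sum>j\<in>UNIV. D u x $ j * (w $ j - v $ j))" for u v w x
    unfolding F_def inner_vec_def by (simp add: algebra_simps flip: sum.distrib)
  have "norm (u - v) \<le> (norm1 lS + norm1 lD) / \<eta> /
      (1 - (1 + (norm1 lS + norm1 lD) / \<eta>) * norm1 l) * norm (x - y)"
  proof (rule translated_vi_solutions_bound[of F \<eta>])
    show "F v x \<bullet> (v - u) \<ge> \<eta> * (norm (v - u))\<^sup>2" if "F u x \<bullet> (v - u) \<ge> 0" for x u v
      using mono[where ?u1.0 = u and ?u2.0 = v and x = x] that unfolding F_inner by blast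
    show "norm (F u x - F v y) \<le> (norm1 lS + norm1 lD) * (norm (x - y) + norm (u - v))" for x y u v
    proof -
      have "norm (F u x - F v y) \<le> norm (S u x - S v y) + norm (D u x - D v y)"
        unfolding F_def using norm_triangle_ineq4[of "S u x - S v y" "D u x - D v y"]
        by (simp add: algebra_simps)
      also have "\<dots> \<le> norm1 lS * (norm (x - y) + norm (u - v)) + norm1 lD * (norm (x - y) + norm (u - v))"
        by (intro add_mono norm_le_norm1_mult) (simp_all add: lip_S lip_D)
      finally show ?thesis by (simp add: algebra_simps)
    qed
    show "norm (p v - p u) \<le> norm1 l * norm (u - v)"
      using shift_lipschitz[of l \<psi> v u, OF lip] by (simp add: p_def norm_minus_commute)
    have "v - (p v - p u) \<in> price_set a b u" "u + (p v - p u) \<in> price_set a b v"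
      using sol unfolding solves_qvi_def price_set by (simp_all add: algebra_simps)
    thus "F u x \<bullet> (v - (p v - p u) - u) \<ge> 0" "F v y \<bullet> (u + (p v - p u) - v) \<ge> 0"
      using sol unfolding solves_qvi_def F_def by blast+
    show "norm1 lS + norm1 lD \<ge> 0"
      by (simp add: norm1_def sum_nonneg)
  qed (use \<eta> small in \<open>simp_all add: r_def\<close>)
  thus ?thesis by (simp only: r_def)
qed

theorem theorem5p7:
  fixes T q :: real and k :: nat and t \<iota> :: "nat \<Rightarrow> real"
    and x0 :: "real ^ 'n::finite"
    and chi :: "real \<Rightarrow> real ^ 'n \<Rightarrow> real ^ 'n"
    and theta :: "real \<Rightarrow> real ^ 'n \<Rightarrow> real ^ 'm::finite \<Rightarrow> real ^ 'n"
    and S D :: "real ^ 'm \<Rightarrow> real ^ 'n \<Rightarrow> real ^ 'm"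
    and a b \<psi> :: "'m \<Rightarrow> ('m \<Rightarrow> real) \<Rightarrow> real"
    and c d :: "'m \<Rightarrow> real"
    and \<eta> l_theta l_chi :: real and l lS lD :: "real ^ 'm"
    and \<phi> :: "real \<Rightarrow> real"
  assumes T: "T > 0" and q: "0 < q" "q \<le> 1"
    and t: "\<And>i. i \<in> {1..k} \<Longrightarrow> 0 < t i \<and> t i < T" "mono_on {1..k} t"
    and A1_const: "\<eta> > 0" "\<And>j. lS $ j > 0" "\<And>j. lD $ j > 0"
    and A1_mono: "\<And>x u1 u2.
        (\<Sum>j\<in>UNIV. S u1 x $ j * (u2 $ j - u1 $ j))
          + (\<Sum>j\<in>UNIV. D u1 x $ j * (u1 $ j - u2 $ j)) \<ge> 0 \<Longrightarrow>
        (\<Sum>j\<in>UNIV. S u2 x $ j * (u2 $ j - u1 $ j))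
          + (\<Sum>j\<in>UNIV. D u2 x $ j * (u1 $ j - u2 $ j)) \<ge> \<eta> * (norm (u2 - u1))^2"
    and A1_lip_S: "\<And>x1 x2 u1 u2 j.
        \<bar>S u1 x1 $ j - S u2 x2 $ j\<bar> \<le> lS $ j * (norm (x1 - x2) + norm (u1 - u2))"
    and A1_lip_D: "\<And>x1 x2 u1 u2 j.
        \<bar>D u1 x1 $ j - D u2 x2 $ j\<bar> \<le> lD $ j * (norm (x1 - x2) + norm (u1 - u2))"
    and A2_bounds: "\<And>j w. w \<in> extensional (- {j}) \<Longrightarrow> a j w = \<psi> j w + c j"
        "\<And>j w. w \<in> extensional (- {j}) \<Longrightarrow> b j w = \<psi> j w + d j"
    and A2_const: "\<And>j. 0 < c j" "\<And>j. c j < d j"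
    and A2_lip: "\<And>j. lipschitz_omit j (l $ j) (\<psi> j)"
    and A2_small: "2 * ((norm1 l)^2 / \<eta>^2) *
        ((norm1 lS + norm1 lD) * sqrt (4 * (norm1 lS + norm1 lD)^2 + 2 * \<eta>^2)
          + 2 * (norm1 lS + norm1 lD)^2 + \<eta>^2) < 1"
    and A3_cont: "continuous_on ({0..T} \<times> UNIV \<times> UNIV) (\<lambda>(s, x, u). theta s x u)"
    and A3_lip: "l_theta > 0" "\<And>s x1 x2 u1 u2. s \<in> {0..T} \<Longrightarrow>
        norm (theta s x2 u2 - theta s x1 u1) \<le> l_theta * (norm (x2 - x1) + norm (u2 - u1))"
    and A4_cont: "continuous_on ({0..T} \<times> UNIV) (\<lambda>(s, x). chi s x)"
    and A4_lip: "l_chi > 0" "\<And>s x1 x2. s \<in> {0..T} \<Longrightarrow>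
        norm (chi s x2 - chi s x1) \<le> l_chi * norm (x2 - x1)"
    and A5: "0 < (\<Sum>i=1..k. \<bar>\<iota> i\<bar>)" "(\<Sum>i=1..k. \<bar>\<iota> i\<bar>) < 1"
    and \<phi>: "continuous_on {0..T} \<phi>" "\<And>s. s \<in> {0..T} \<Longrightarrow> 0 \<le> \<phi> s" "mono_on {0..T} \<phi>"
  shows "gen_MLHUR_stable T q k t \<iota> x0 chi theta S D a b \<phi>"
proof -
  define r where "r = (norm1 lS + norm1 lD) / \<eta>"
  define L where "L = r / (1 - (1 + r) * norm1 l)"
  \<comment> \<open>Lipschitz constant in the state of the right-hand side once the price is eliminated.\<close>
  define M where "M = l_chi + l_theta * (1 + L)"
  define C where "C = exp ((2 * M) powr (1 / q) * T) / M"
  have norm1_nonneg: "norm1 w \<ge> 0" for w :: "real ^ 'm"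
    by (simp add: norm1_def sum_nonneg)
  have small: "(1 + r) * norm1 l < 1"
    unfolding r_def using A2_small A1_const(1)
    by (intro contraction_constant_less_1) (auto intro: add_nonneg_nonneg norm1_nonneg)
  have qvi: "norm (u - v) \<le> L * norm (x - y)"
    if "solves_qvi S D a b x u" "solves_qvi S D a b y v" for x y u v
    unfolding L_def r_def
    by (rule solves_qvi_lipschitz[OF A1_const(1) A1_mono A1_lip_S A1_lip_D A2_bounds A2_lip
          small[unfolded r_def] that])
  have "L \<ge> 0"
    using small A1_const(1) by (simp add: L_def r_def norm1_nonneg)
  hence M: "M > 0"
    using A3_lip(1) A4_lip(1) by (simp add: M_def add_pos_nonneg)
  have bound: "norm (z s - x s) \<le> C * \<phi> s * mittag_leffler q s"
    if z: "pcp_perturbed_solution T q chi theta S D a b \<phi> z \<upsilon>"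
      and x: "pcp_solution T q k t \<iota> x0 chi theta S D a b x u"
      and init: "z 0 = x 0" and s: "s \<in> {0..T}" for z \<upsilon> x u s
  proof -
    obtain y where y: "continuous_on {0..T} y" "has_caputo_derivative_on q T z y"
      "\<And>s. s \<in> {0..T} \<Longrightarrow> norm (y s - chi s (z s) - theta s (z s) (\<upsilon> s)) \<le> \<phi> s"
      using z unfolding pcp_perturbed_solution_def by blast
    have cont: "continuous_on {0..T} z" "continuous_on {0..T} x" "continuous_on {0..T} u"
      using z x unfolding pcp_perturbed_solution_def pcp_solution_def by auto
    define f where "f = (\<lambda>\<zeta>. chi \<zeta> (x \<zeta>) + theta \<zeta> (x \<zeta>) (u \<zeta>))"
    have f: "continuous_on {0..T} f"
    proof -
      have "continuous_on {0..T} (\<lambda>\<zeta>. case (\<zeta>, x \<zeta>) of (s, x) \<Rightarrow> chi s x)"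
        by (rule continuous_on_compose2[OF A4_cont]) (auto intro!: continuous_intros cont)
      moreover have "continuous_on {0..T} (\<lambda>\<zeta>. case (\<zeta>, x \<zeta>, u \<zeta>) of (s, x, u) \<Rightarrow> theta s x u)"
        by (rule continuous_on_compose2[OF A3_cont]) (auto intro!: continuous_intros cont)
      ultimately show ?thesis
        unfolding f_def by (auto intro: continuous_on_add)
    qed
    \<comment> \<open>The nonlocal condition is absorbed into the initial value: the integral vanishes at \<open>0\<close>.\<close>
    have x_eq: "x s = x 0 + rl_integral q f s" if "s \<in> {0..T}" for s
    proof -
      have *: "x s = x0 + (\<Sum>i=1..k. \<iota> i *\<^sub>R x (t i)) + rl_integral q f s" if "s \<in> {0..T}" for s
        using x that unfolding pcp_solution_def f_def by blast
      from *[OF that] *[of 0] show ?thesis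
        using T q by (simp add: rl_integral_at_0)
    qed
    have "norm (z s - x s) \<le> C * \<phi> s"
      unfolding C_def
    proof (rule fractional_Gronwall[OF q(1) M _ _ _ \<phi>(2,3) s])
      show "continuous_on {0..T} (\<lambda>s. y s - f s)"
        by (intro continuous_intros y(1) f)
      fix s assume s: "s \<in> {0..T}"
      have "rl_integral q (\<lambda>s. y s - f s) s = rl_integral q y s - rl_integral q f s"
        using s q y(1) f by (intro rl_integral_diff) (auto intro: continuous_on_subset)
      thus "z s - x s = rl_integral q (\<lambda>s. y s - f s) s"
        using caputo_derivative_imp_integral_equation[OF T q cont(1) y(1,2) s] x_eq[OF s] init
        by simp
      have "norm (\<upsilon> s - u s) \<le> L * norm (z s - x s)"
        using z x s unfolding pcp_perturbed_solution_def pcp_solution_def by (intro qvi) blast+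
      hence "norm (theta s (z s) (\<upsilon> s) - theta s (x s) (u s)) \<le> l_theta * (norm (z s - x s) + L * norm (z s - x s))"
        using A3_lip(1) by (intro order_trans[OF A3_lip(2)[OF s]] mult_left_mono) auto
      moreover have "norm (chi s (z s) - chi s (x s)) \<le> l_chi * norm (z s - x s)"
        by (rule A4_lip(2)[OF s])
      moreover have "y s - f s = (y s - chi s (z s) - theta s (z s) (\<upsilon> s))
          + (chi s (z s) - chi s (x s)) + (theta s (z s) (\<upsilon> s) - theta s (x s) (u s))"
        by (simp add: f_def)
      ultimately have "norm (y s - f s) \<le> \<phi> s + l_chi * norm (z s - x s)
          + l_theta * (norm (z s - x s) + L * norm (z s - x s))"
        using y(3)[OF s] by (metis (no_types, lifting) add_mono norm_triangle_mono)
      thus "norm (y s - f s) \<le> \<phi> s + M * norm (z s - x s)"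
        by (simp add: M_def algebra_simps)
    qed
    also have "C * \<phi> s * 1 \<le> C * \<phi> s * mittag_leffler q s"
      using M s q \<phi>(2)[OF s] mittag_leffler_ge_1[of q s] by (intro mult_left_mono) (auto simp: C_def)
    finally show ?thesis by simp
  qed
  have "C > 0" using M by (simp add: C_def)
  thus ?thesis
    unfolding gen_MLHUR_stable_def using bound by blast
qed

end
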